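(* Consider the leader-follower game described in the context. Suppose that: Upper level: (i) the leader's payoff function $f(x,\boldsymbol{y})$ is continuous with respect to $(x,\boldsymbol{y})\in X\times\prod_{i=1}^I Y_i$; (ii) the leader's strategy space $X$ is a non-empty, compact set. Lower level: (i) for each $i\in N$ and any $x\in X$ and $y_{-i}\in Y_{-i}$, the payoff function $\varphi_i(x,y_{-i},y_i)$ of follower $i$ is convex (in $y_i$), and $\varphi_i$ is continuous with respect to $(x,y_{-i},y_i)\in X\times\prod_{i=1}^I Y_i$; (ii) for any $i\in N$, $\mu_i(x)$ is continuous with respect to $x\in X$, and the constant $b_i>0$; (iii) for any $i\in N$, $Y_i$ is a non-empty, compact, and convex set that contains the origin. Then for any $i\in N$, the set-valued map $S_{F,i}:X\rightrightarrows Y_i$ given by $$S_{F,i}(x)=\left\{y_i\in Y_i:\ \mu_i(x)y_i+l_i\sqrt{\Sigma_i y_i^2}\le b_i\right\}$$ has the following properties: (i) $S_{F,i}$ is continuous with respect to $x\in X$; (ii) for any $x\in X$, $S_{F,i}(x)$ is a compact and convex set.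
   Context: There is one leader with strategy $x\in X\subseteq\mathbb{R}^m$ and payoff $f:X\times\prod_{i=1}^I Y_i\to\mathbb{R}$, and followers $i\in N=\{1,\dots,I\}$ with strategies $y_i\in Y_i\subseteq\mathbb{R}$ and payoffs $\varphi_i:X\times Y_{-i}\times Y_i\to\mathbb{R}$. Here $\boldsymbol{y}=(y_1,\dots,y_I)$, $y_{-i}=(y_1,\dots,y_{i-1},y_{i+1},\dots,y_I)$ and $Y_{-i}=\prod_{j\ne i}Y_j$. For each $i$: $\mu_i(\cdot):X\to\mathbb{R}$ is a function, $\Sigma_i\ge0$ is a constant (the variance of a finite sample of real numbers), $b_i$ is a constant, $\gamma_{i,1}>0$ and $\gamma_{i,2}>1$ are parameters, $\alpha_i\in(0,1)$, and $$l_i=\begin{cases}\sqrt{\gamma_{i,1}}+\sqrt{\left(\frac{1-\alpha_i}{\alpha_i}\right)\left(\gamma_{i,2}-\gamma_{i,1}\right)}, & \text{when } \gamma_{i,1}/\gamma_{i,2}\le\alpha_i,\\ \sqrt{\gamma_{i,2}/\alpha_i}, & \text{when } \gamma_{i,1}/\gamma_{i,2}>\alpha_i.\end{cases}$$ A set-valued map $S:X\rightrightarrows Y_i$ (with $Y_i$ compact) is upper semicontinuous at $x$ if whenever $x_j\to x$ in $X$, $y_{i,j}\in S(x_j)$ for all $j$ and $y_{i,j}\to y_i$, then $y_i\in S(x)$; it is lower semicontinuous at $x$ if for any $x_j\to x$ in $X$ and any $y_i\in S(x)$ there are, for all sufficiently large $j$, points $y_{i,j}\in S(x_j)$ with $y_{i,j}\to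 y_i$; it is continuous if it is both upper and lower semicontinuous. *)

theory Defs
  imports "HOL-Analysis.Analysis"
begin

text \<open>
  Followers are indexed by an arbitrary finite type, so a joint follower strategy is a vector in
  \<^typ>\<open>real ^ 'i\<close>. A pair consisting of the rivals' strategies and the own strategy of follower
  \<open>i\<close> is identified with the joint vector \<open>with_own i y t\<close>, which does not depend on \<open>y $ i\<close>.
\<close>

definition strategy_profiles :: "('i::finite \<Rightarrow> real set) \<Rightarrow> (real ^ 'i) set" where
  "strategy_profiles Y = {y. \<forall>i. y $ i \<in> Y i}"

definition with_own :: "'i::finite \<Rightarrow> real ^ 'i \<Rightarrow> real \<Rightarrow> real ^ 'i" where
  "with_own i y t = (\<chi> j. if j = i then t else y $ j)"

definition safety_coeff :: "real \<Rightarrow> real \<Rightarrow> real \<Rightarrow> real" where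
  "safety_coeff \<alpha> \<gamma>1 \<gamma>2 =
     (if \<gamma>1 / \<gamma>2 \<le> \<alpha> then sqrt \<gamma>1 + sqrt ((1 - \<alpha>) / \<alpha> * (\<gamma>2 - \<gamma>1))
      else sqrt (\<gamma>2 / \<alpha>))"

definition feasible_set ::
  "real set \<Rightarrow> ('x \<Rightarrow> real) \<Rightarrow> real \<Rightarrow> real \<Rightarrow> real \<Rightarrow> 'x \<Rightarrow> real set" where
  "feasible_set Y \<mu> l \<Sigma> b x = {y \<in> Y. \<mu> x * y + l * sqrt (\<Sigma> * y\<^sup>2) \<le> b}"

text \<open>
  Semicontinuity of a set-valued map on \<open>X\<close>, in sequential form. Upper semicontinuity here is the
  closed-graph condition, which for closed values inside a fixed compact set agrees with the open-set formulation.
\<close>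

definition usc_at ::
  "'a::topological_space set \<Rightarrow> ('a \<Rightarrow> 'b::topological_space set) \<Rightarrow> 'a \<Rightarrow> bool" where
  "usc_at X S x \<longleftrightarrow>
     (\<forall>u v y. (\<forall>j. u j \<in> X) \<longrightarrow> u \<longlonglongrightarrow> x \<longrightarrow> (\<forall>j. v j \<in> S (u j)) \<longrightarrow> v \<longlonglongrightarrow> y \<longrightarrow> y \<in> S x)"

definition lsc_at ::
  "'a::topological_space set \<Rightarrow> ('a \<Rightarrow> 'b::topological_space set) \<Rightarrow> 'a \<Rightarrow> bool" where
  "lsc_at X S x \<longleftrightarrow>
     (\<forall>u y. (\<forall>j. u j \<in> X) \<longrightarrow> u \<longlonglongrightarrow> x \<longrightarrow> y \<in> S x \<longrightarrow>
        (\<exists>v. (\<forall>\<^sub>F j in sequentially. v j \<in> S (u j)) \<and> v \<longlonglongrightarrow> y))"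

definition set_valued_continuous_on ::
  "'a::topological_space set \<Rightarrow> ('a \<Rightarrow> 'b::topological_space set) \<Rightarrow> bool" where
  "set_valued_continuous_on X S \<longleftrightarrow> (\<forall>x\<in>X. usc_at X S x \<and> lsc_at X S x)"

end

theory Submission
  imports Defs
begin

text \<open>
  The constraint function \<open>h x y = \<mu> x * y + l * sqrt (\<Sigma> * y\<^sup>2)\<close> equals \<open>\<mu> x * y + c * \<bar>y\<bar>\<close> with
  \<open>c = l * sqrt \<Sigma> \<ge> 0\<close>: it is jointly continuous, and convex and positively homogeneous in \<open>y\<close>.
  Compactness and upper semicontinuity come from continuity, since non-strict inequalities and
  membership in the closed strategy set survive limits. Convexity comes from convexity of
  \<open>h x\<close>, for which the sign of \<open>l\<close> matters (\<open>safety_coeff_nonneg\<close>).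

  Lower semicontinuity (\<open>lsc_at_homogeneous_sublevel\<close>) is the substantial part: a point \<open>y\<close> on the boundary of the feasible set
  at \<open>x\<close> may become infeasible at nearby parameters. The origin is feasible with slack \<open>b > 0\<close>
  at every parameter, so \<open>y\<close> can be repaired by shrinking it towards the origin. By homogeneity,
  \<open>t *\<^sub>R y\<close> with \<open>t = b / max b (h x' y)\<close> is feasible at \<open>x'\<close>, and \<open>t\<close> tends to \<open>1\<close> as
  \<open>x'\<close> tends to \<open>x\<close> because \<open>h x y \<le> b\<close>.
\<close>

lemma usc_at_sublevel:
  fixes h :: "'a::topological_space \<Rightarrow> 'b::first_countable_topology \<Rightarrow> real"
  assumes "closed Y" and "x \<in> X"
    and h_cont: "continuous_on (X \<times> Y) (\<lambda>(x, y). h x y)"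
  shows "usc_at X (\<lambda>x. {y \<in> Y. h x y \<le> b}) x"
  unfolding usc_at_def
proof (intro allI impI)
  fix u v y
  assume u: "\<forall>j. u j \<in> X" "u \<longlonglongrightarrow> x"
    and v: "\<forall>j. v j \<in> {y \<in> Y. h (u j) y \<le> b}" "v \<longlonglongrightarrow> y"
  have "y \<in> Y"
    using closed_sequentially[OF \<open>closed Y\<close>, of v y] v by auto
  have "(\<lambda>j. (u j, v j)) \<longlonglongrightarrow> (x, y)"
    using u(2) v(2) by (rule tendsto_Pair)
  then have "(\<lambda>j. h (u j) (v j)) \<longlonglongrightarrow> h x y"
    using continuous_on_tendsto_compose[OF h_cont, of "\<lambda>j. (u j, v j)" "(x, y)"]
      u(1) v(1) \<open>x \<in> X\<close> \<open>y \<in> Y\<close> by simp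
  then have "h x y \<le> b"
    using v(1) by (intro LIMSEQ_le_const2) auto
  with \<open>y \<in> Y\<close> show "y \<in> {y \<in> Y. h x y \<le> b}"
    by simp
qed

text \<open>
  The approximating points are multiples of the single point \<open>y\<close> by factors in \<open>[0, 1]\<close>, so only
  the behaviour on the segment from \<open>0\<close> to \<open>y\<close> enters: \<open>Y\<close> need only be star-shaped about the
  origin, and \<open>h\<close> continuous in the parameter for each fixed \<open>y\<close>.
\<close>

lemma lsc_at_homogeneous_sublevel:
  fixes h :: "'a::topological_space \<Rightarrow> 'b::real_normed_vector \<Rightarrow> real"
  assumes "b > 0" and "x \<in> X"
    and star: "\<And>t y. y \<in> Y \<Longrightarrow> 0 \<le> t \<Longrightarrow> t \<le> 1 \<Longrightarrow> t *\<^sub>R y \<in> Y"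
    and homogeneous: "\<And>x t y. x \<in> X \<Longrightarrow> y \<in> Y \<Longrightarrow> 0 \<le> t \<Longrightarrow> t \<le> 1 \<Longrightarrow> h x (t *\<^sub>R y) = t * h x y"
    and h_cont: "\<And>y. y \<in> Y \<Longrightarrow> continuous_on X (\<lambda>x. h x y)"
  shows "lsc_at X (\<lambda>x. {y \<in> Y. h x y \<le> b}) x"
  unfolding lsc_at_def
proof (intro allI impI)
  fix u y
  assume u: "\<forall>j. u j \<in> X" "u \<longlonglongrightarrow> x" and "y \<in> {y \<in> Y. h x y \<le> b}"
  then have y: "y \<in> Y" "h x y \<le> b"
    by auto
  define t where "t j = b / max b (h (u j) y)" for j
  have t: "0 \<le> t j" "t j \<le> 1" for j
    using \<open>b > 0\<close> by (auto simp: t_def field_simps)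
  have "t j *\<^sub>R y \<in> {y \<in> Y. h (u j) y \<le> b}" for j
  proof -
    have "t j * h (u j) y \<le> t j * max b (h (u j) y)"
      using t by (intro mult_left_mono) auto
    also have "\<dots> = b"
      using \<open>b > 0\<close> by (simp add: t_def)
    finally show ?thesis
      using star y(1) t u(1) homogeneous by simp
  qed
  moreover have "(\<lambda>j. t j *\<^sub>R y) \<longlonglongrightarrow> y"
  proof -
    have "(\<lambda>j. h (u j) y) \<longlonglongrightarrow> h x y"
      using continuous_on_tendsto_compose[OF h_cont[OF y(1)] u(2)] u(1) \<open>x \<in> X\<close> by simp
    then have "t \<longlonglongrightarrow> b / max b (h x y)"
      unfolding t_def using \<open>b > 0\<close> by (intro tendsto_intros) auto
    also have "b / max b (h x y) = 1"
      using y(2) \<open>b > 0\<close> by (simp add: max_def)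
    finally have "(\<lambda>j. t j *\<^sub>R y) \<longlonglongrightarrow> 1 *\<^sub>R y"
      by (intro tendsto_intros)
    then show ?thesis
      by simp
  qed
  ultimately show "\<exists>v. (\<forall>\<^sub>F j in sequentially. v j \<in> {y \<in> Y. h (u j) y \<le> b}) \<and> v \<longlonglongrightarrow> y"
    by (intro exI[of _ "\<lambda>j. t j *\<^sub>R y"]) simp
qed

lemma safety_coeff_nonneg:
  assumes "\<alpha> \<in> {0<..<1}" "\<gamma>1 > 0" "\<gamma>2 > 0"
  shows "safety_coeff \<alpha> \<gamma>1 \<gamma>2 \<ge> 0"
proof (cases "\<gamma>1 / \<gamma>2 \<le> \<alpha>")
  case True
  \<comment> \<open>In this branch the second radicand is nonnegative, because \<open>\<alpha> < 1\<close> forces \<open>\<gamma>1 < \<gamma>2\<close>.\<close>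
  then have "\<gamma>1 / \<gamma>2 < 1"
    using assms(1) unfolding greaterThanLessThan_iff by linarith
  then have "\<gamma>1 < \<gamma>2"
    using assms by (simp only: divide_less_eq_1_pos)
  then show ?thesis
    using assms True by (simp add: safety_coeff_def)
next
  case False
  then show ?thesis
    using assms by (simp add: safety_coeff_def)
qed

lemma feasible_set_abs:
  "feasible_set Y \<mu> l \<Sigma> b = (\<lambda>x. {y \<in> Y. \<mu> x * y + l * sqrt \<Sigma> * \<bar>y\<bar> \<le> b})"
  by (simp add: fun_eq_iff feasible_set_def real_sqrt_mult mult.assoc)

lemma set_valued_continuous_on_feasible_set:
  fixes X :: "'a::topological_space set"
  assumes "continuous_on X \<mu>" "b > 0" "closed Y" "convex Y" "0 \<in> Y"
  shows "set_valued_continuous_on X (feasible_set Y \<mu> l \<Sigma> b)"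
  unfolding set_valued_continuous_on_def feasible_set_abs
proof (intro ballI conjI)
  fix x assume "x \<in> X"
  have "continuous_on (X \<times> Y) (\<lambda>p. \<mu> (fst p))"
    by (rule continuous_on_compose2[OF \<open>continuous_on X \<mu>\<close>]) (auto intro: continuous_intros)
  then have "continuous_on (X \<times> Y) (\<lambda>(x, y). \<mu> x * y + l * sqrt \<Sigma> * \<bar>y\<bar>)"
    unfolding case_prod_unfold by (intro continuous_intros)
  then show "usc_at X (\<lambda>x. {y \<in> Y. \<mu> x * y + l * sqrt \<Sigma> * \<bar>y\<bar> \<le> b}) x"
    using \<open>closed Y\<close> \<open>x \<in> X\<close> by (intro usc_at_sublevel)
  have "t * y \<in> Y" if "y \<in> Y" "0 \<le> t" "t \<le> 1" for t y
    using convexD_alt[OF \<open>convex Y\<close> \<open>0 \<in> Y\<close> \<open>y \<in> Y\<close>, of t] that by simp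
  then show "lsc_at X (\<lambda>x. {y \<in> Y. \<mu> x * y + l * sqrt \<Sigma> * \<bar>y\<bar> \<le> b}) x"
    using \<open>b > 0\<close> \<open>x \<in> X\<close> \<open>continuous_on X \<mu>\<close>
    by (intro lsc_at_homogeneous_sublevel)
      (auto simp: abs_mult distrib_left mult.left_commute intro!: continuous_intros)
qed

lemma compact_feasible_set:
  assumes "compact Y"
  shows "compact (feasible_set Y \<mu> l \<Sigma> b x)"
proof -
  have "closed {y. \<mu> x * y + l * sqrt \<Sigma> * \<bar>y\<bar> \<le> b}"
    by (intro closed_Collect_le continuous_intros)
  then have "compact (Y \<inter> {y. \<mu> x * y + l * sqrt \<Sigma> * \<bar>y\<bar> \<le> b})"
    by (rule compact_Int_closed[OF assms])
  then show ?thesis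
    by (simp add: feasible_set_abs Int_def)
qed

lemma convex_sublevel:
  assumes "convex_on S f"
  shows "convex {x \<in> S. f x \<le> b}"
proof (rule convexI)
  fix x y and u v :: real
  assume xy: "x \<in> {x \<in> S. f x \<le> b}" "y \<in> {x \<in> S. f x \<le> b}"
    and uv: "0 \<le> u" "0 \<le> v" "u + v = 1"
  have "f (u *\<^sub>R x + v *\<^sub>R y) \<le> max (f x) (f y)"
    using convex_lower[OF assms _ _ uv] xy by simp
  moreover have "u *\<^sub>R x + v *\<^sub>R y \<in> S"
    using convexD[OF convex_on_imp_convex[OF assms] _ _ uv] xy by simp
  ultimately show "u *\<^sub>R x + v *\<^sub>R y \<in> {x \<in> S. f x \<le> b}"
    using xy by auto
qed

lemma convex_feasible_set:
  assumes "convex Y" "l \<ge> 0" "\<Sigma> \<ge> 0"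
  shows "convex (feasible_set Y \<mu> l \<Sigma> b x)"
proof -
  have "convex_on Y (\<lambda>y. l * sqrt \<Sigma> * \<bar>y\<bar>)"
    using convex_on_dist[of Y "0::real"] assms
    by (intro convex_on_cmul) (auto simp: dist_real_def)
  moreover have "convex_on Y (\<lambda>y. \<mu> x * y)"
    using \<open>convex Y\<close> by (intro convex_onI) (auto simp: algebra_simps)
  ultimately have "convex_on Y (\<lambda>y. \<mu> x * y + l * sqrt \<Sigma> * \<bar>y\<bar>)"
    by (intro convex_on_add)
  then show ?thesis
    unfolding feasible_set_abs by (rule convex_sublevel)
qed

theorem lemma4:
  fixes X :: "(real ^ 'm) set"
    and Y :: "'i::finite \<Rightarrow> real set"
    and f :: "real ^ 'm \<Rightarrow> real ^ 'i \<Rightarrow> real"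
    and \<phi> :: "'i \<Rightarrow> real ^ 'm \<Rightarrow> real ^ 'i \<Rightarrow> real"
    and \<mu> :: "'i \<Rightarrow> real ^ 'm \<Rightarrow> real"
    and \<Sigma> b \<alpha> \<gamma>1 \<gamma>2 :: "'i \<Rightarrow> real"
  assumes f_cont: "continuous_on (X \<times> strategy_profiles Y) (\<lambda>(x, y). f x y)"
    and X: "X \<noteq> {}" "compact X"
    and \<phi>_convex: "\<And>i x y. x \<in> X \<Longrightarrow> (\<And>j. j \<noteq> i \<Longrightarrow> y $ j \<in> Y j) \<Longrightarrow>
          convex_on (Y i) (\<lambda>t. \<phi> i x (with_own i y t))"
    and \<phi>_cont: "\<And>i. continuous_on (X \<times> strategy_profiles Y) (\<lambda>(x, y). \<phi> i x y)"
    and \<mu>_cont: "\<And>i. continuous_on X (\<mu> i)"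
    and b: "\<And>i. b i > 0"
    and Y: "\<And>i. Y i \<noteq> {}" "\<And>i. compact (Y i)" "\<And>i. convex (Y i)" "\<And>i. 0 \<in> Y i"
    and \<Sigma>: "\<And>i. \<Sigma> i \<ge> 0"
    and \<alpha>: "\<And>i. \<alpha> i \<in> {0<..<1}"
    and \<gamma>: "\<And>i. \<gamma>1 i > 0" "\<And>i. \<gamma>2 i > 1"
  shows "\<forall>i. set_valued_continuous_on X
               (feasible_set (Y i) (\<mu> i) (safety_coeff (\<alpha> i) (\<gamma>1 i) (\<gamma>2 i)) (\<Sigma> i) (b i)) \<and>
             (\<forall>x\<in>X.
               compact (feasible_set (Y i) (\<mu> i) (safety_coeff (\<alpha> i) (\<gamma>1 i) (\<gamma>2 i)) (\<Sigma> i) (b i) x) \<and>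
               convex (feasible_set (Y i) (\<mu> i) (safety_coeff (\<alpha> i) (\<gamma>1 i) (\<gamma>2 i)) (\<Sigma> i) (b i) x))"
proof (intro allI conjI ballI)
  fix i
  show "set_valued_continuous_on X
          (feasible_set (Y i) (\<mu> i) (safety_coeff (\<alpha> i) (\<gamma>1 i) (\<gamma>2 i)) (\<Sigma> i) (b i))"
    using \<mu>_cont b Y by (intro set_valued_continuous_on_feasible_set compact_imp_closed)
next
  fix i x
  show "compact (feasible_set (Y i) (\<mu> i) (safety_coeff (\<alpha> i) (\<gamma>1 i) (\<gamma>2 i)) (\<Sigma> i) (b i) x)"
    using Y(2) by (rule compact_feasible_set)
next
  fix i x
  have "\<gamma>2 i > 0"
    using \<gamma>(2)[of i] by linarith
  then show "convex (feasible_set (Y i) (\<mu> i) (safety_coeff (\<alpha> i) (\<gamma>1 i) (\<gamma>2 i)) (\<Sigma> i) (b i) x)"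
    by (intro convex_feasible_set safety_coeff_nonneg Y \<Sigma> \<alpha> \<gamma>)
qed

end
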